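(* Let $G$ be a strongly regular graph, of degree $r$ and on $n$ vertices. Then $G$ is $D$-magic if and only if (1) $D=\{0,1\}$ and $G\cong K_n$, or (2) $D=\{0,2\}$ and $G\cong H_{n-r,\frac{n}{n-r}}$, where $n-r$ is even or both $n-r$ and $\frac{n}{n-r}$ are odd, or (3) $D=\{0,1,2\}$, or (4) $D=\{1\}$ and $G\cong H_{n-r,\frac{n}{n-r}}$, where $n-r$ is even or both $n-r$ and $\frac{n}{n-r}$ are odd, or (5) $D=\{2\}$ and $G\cong K_n$.
   Context: Graphs are finite and simple. A distance-regular graph is a regular connected graph with degree $r$ and diameter $d$, for which there are positive integers $b_0=r,b_1,\ldots,b_{d-1},c_1=1,c_2,\ldots,c_d$ such that for any two vertices $u,v$ at distance $i$, there are precisely $c_i$ neighbours of $u$ at distance $i-1$ from $v$ ($1\le i\le d$) and precisely $b_i$ neighbours of $u$ at distance $i+1$ from $v$ ($0\le i\le d-1$). A strongly regular graph is a distance-regular graph of diameter at most $2$. Let $G$ be a graph on $n$ vertices with diameter $d$, and let $D\subseteq\{0,1,\ldots,d\}$ be a set of distances in $G$. The $D$-neighbourhood set of a vertex $x$ is $N_D(x)=\{y\in V(G): d(x,y)\in D\}$, where $d(x,y)$ is the distance between $x$ and $y$. $G$ is $D$-magic if there exist a bijection $f:V(G)\to\{1,2,\ldots,n\}$ and a constant $k$ such that $\sum_{y\in N_D(x)}f(y)=k$ for every vertex $x$. $K_n$ denotes the complete graph of order $n$, and $H_{m,p}$ denotes the complete multipartite graph with $p$ partite sets, each consisting of $m$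 vertices.
   Formalization: In (2) and (4) the condition n-r > 1 is added (K_3 = H_{1,3} with D={1} or {0,2} would be a counterexample); D is a nonempty subset of {0,1,2} (the empty D is trivially magic); the one-vertex graph is excluded since b_0=r is positive. *)

theory Defs
  imports "Graph_Theory.Graph_Theory" "HOL-Library.Disjoint_Sets"
begin

text \<open>
  Finite simple graphs are the \<open>graph\<close>s of \<open>Graph_Theory\<close>: finite, symmetric, loop-free
  digraphs without parallel arcs, where \<open>u \<rightarrow>\<^bsub>G\<^esub> v\<close> is adjacency.  In such a graph the number
  of neighbours of a vertex is its \<open>out_degree\<close>.
\<close>

text \<open>
  The distance is the library's shortest-path value \<open>\<mu>\<close> for unit weights, i.e. the infimum of
  the lengths of the walks from \<open>u\<close> to \<open>v\<close>; it is \<open>\<infinity>\<close> if there is no such walk.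
\<close>

definition graph_dist :: "('a,'b) pre_digraph \<Rightarrow> 'a \<Rightarrow> 'a \<Rightarrow> ereal" where
  "graph_dist G u v = wf_digraph.\<mu> G (\<lambda>_. 1) u v"

definition graph_diameter :: "('a,'b) pre_digraph \<Rightarrow> ereal" where
  "graph_diameter G = (SUP u\<in>verts G. SUP v\<in>verts G. graph_dist G u v)"

text \<open>
  All intersection numbers, in particular \<open>b 0 = r\<close>, are positive; this excludes the graph with a
  single vertex, for which \<open>r = 0\<close> and \<open>d = 0\<close>.
\<close>

definition distance_regular :: "('a,'b) pre_digraph \<Rightarrow> nat \<Rightarrow> nat \<Rightarrow> bool" where
  "distance_regular G r d \<longleftrightarrow>
     graph G \<and> connected G \<and>
     (\<forall>v\<in>verts G. out_degree G v = r) \<and>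
     graph_diameter G = ereal (real d) \<and>
     (\<exists>b c :: nat \<Rightarrow> nat.
        b 0 = r \<and> 0 < b 0 \<and> c 1 = 1 \<and>
        (\<forall>i<d. 0 < b i) \<and> (\<forall>i\<in>{1..d}. 0 < c i) \<and>
        (\<forall>u\<in>verts G. \<forall>v\<in>verts G. \<forall>i. graph_dist G u v = ereal (real i) \<longrightarrow>
           (1 \<le> i \<and> i \<le> d \<longrightarrow>
              card {w \<in> verts G. u \<rightarrow>\<^bsub>G\<^esub> w \<and> graph_dist G w v = ereal (real (i - 1))} = c i) \<and>
           (i < d \<longrightarrow>
              card {w \<in> verts G. u \<rightarrow>\<^bsub>G\<^esub> w \<and> graph_dist G w v = ereal (real (i + 1))} = b i)))"

definition strongly_regular :: "('a,'b) pre_digraph \<Rightarrow> nat \<Rightarrow> bool" where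
  "strongly_regular G r \<longleftrightarrow> (\<exists>d\<le>2. distance_regular G r d)"

definition D_neighbourhood :: "('a,'b) pre_digraph \<Rightarrow> nat set \<Rightarrow> 'a \<Rightarrow> 'a set" where
  "D_neighbourhood G D x = {y \<in> verts G. \<exists>i\<in>D. graph_dist G x y = ereal (real i)}"

definition D_magic :: "('a,'b) pre_digraph \<Rightarrow> nat set \<Rightarrow> bool" where
  "D_magic G D \<longleftrightarrow>
     (\<exists>(f :: 'a \<Rightarrow> nat) k.
        bij_betw f (verts G) {1..card (verts G)} \<and>
        (\<forall>x\<in>verts G. (\<Sum>y\<in>D_neighbourhood G D x. f y) = k))"

text \<open>
  \<open>G\<close> is a copy of \<open>H\<^bsub>m,p\<^esub>\<close>, in the style of the library's \<open>complete_digraph\<close> (\<open>G\<close> is a copy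
  of \<open>K\<^bsub>n\<^esub>\<close>) and \<open>complete_bipartite_digraph\<close>.
\<close>

definition complete_multipartite_graph :: "nat \<Rightarrow> nat \<Rightarrow> ('a,'b) pre_digraph \<Rightarrow> bool" where
  "complete_multipartite_graph m p G \<longleftrightarrow>
     graph G \<and>
     (\<exists>P. partition_on (verts G) P \<and> card P = p \<and> (\<forall>U\<in>P. card U = m) \<and>
        arcs_ends G = {(u,v). u \<in> verts G \<and> v \<in> verts G \<and> \<not> (\<exists>U\<in>P. u \<in> U \<and> v \<in> U)})"

end

theory Submission
  imports Defs
begin

text \<open>
  All distances are at most \<open>2\<close>, so complementing \<open>D\<close> in \<open>{0, 1, 2}\<close> preserves \<open>D\<close>-magicness and
  only \<open>{}\<close>, \<open>{0}\<close>, \<open>{1}\<close> and \<open>{2}\<close> have to be considered.  A magic labelling \<open>f\<close> for \<open>{1}\<close> or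
  \<open>{2}\<close> satisfies \<open>A f = a 1 + e f\<close> for the adjacency matrix \<open>A\<close>, with \<open>e = 0\<close> or \<open>e = -1\<close>.  As \<open>f\<close>
  is not constant, \<open>e\<close> is a root of the quadratic equation of the strongly regular graph with
  \<open>lam\<close> and \<open>mu\<close> common neighbours of adjacent and of distinct nonadjacent vertices.  For \<open>e = 0\<close>
  this says \<open>mu = r\<close>: nonadjacent vertices have equal neighbourhoods, \<open>G\<close> is complete
  multipartite, and the magic labellings are those with equal sums over the parts.  For \<open>e = -1\<close>
  it says \<open>lam = r - 1\<close>, which forces \<open>G\<close> to be complete.
\<close>

section \<open>Labellings of equipartitions with constant block sums\<close>

text \<open>
  The rows \<open>\<sigma> 0, \<dots>, \<sigma> (m - 1)\<close> form a Kotzig array.  An identity row followed by a reversed row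
  adds a constant to all column sums, so only \<open>m = 0\<close> and \<open>m = 3\<close> need a construction.
\<close>

lemma kotzig_array_3:
  assumes "odd (p :: nat)"
  shows "\<exists>\<sigma> c. (\<forall>j<3::nat. bij_betw (\<sigma> j) {..<p} {..<p}) \<and> (\<forall>i<p. (\<Sum>j<3. \<sigma> j i) = (c :: nat))"
proof -
  from assms obtain q where p: "p = 2 * q + 1"
    by (auto elim: oddE)
  \<comment> \<open>\<open>s1\<close> is the rotation of \<open>{..<p}\<close> by \<open>q\<close>.
    \<open>s2\<close> is what is then missing from the column sum \<open>3 * q\<close>, three times
    the mean entry of a row. It decreases through the even values for \<open>i \<le> q\<close> and
    through the odd ones afterwards, so it is again a permutation.\<close>
  define s1 where "s1 i = (if i \<le> q then i + q else i - q - 1)" for i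
  define s2 where "s2 i = (if i \<le> q then 2 * q - 2 * i else 4 * q + 1 - 2 * i)" for i
  define \<sigma> where "\<sigma> = (\<lambda>j::nat. if j = 0 then (\<lambda>i. i) else if j = 1 then s1 else s2)"
  have bij: "bij_betw s {..<p} {..<p}" if "inj_on s {..<p}" "\<And>i. i < p \<Longrightarrow> s i < p" for s
  proof -
    have "s ` {..<p} \<subseteq> {..<p}" using that(2) by auto
    with that(1) show ?thesis
      by (metis bij_betw_def endo_inj_surj finite_lessThan)
  qed
  have inj1: "inj_on s1 {..<p}"
    by (rule inj_onI) (auto simp: s1_def p split: if_splits)
  have inj2: "inj_on s2 {..<p}"
  proof (rule inj_onI)
    fix x y assume "x \<in> {..<p}" "y \<in> {..<p}" "s2 x = s2 y"
    then show "x = y" unfolding s2_def p lessThan_iff by (simp split: if_splits; presburger)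
  qed
  have "bij_betw s1 {..<p} {..<p}"
    by (rule bij[OF inj1]) (auto simp: s1_def p)
  moreover have "bij_betw s2 {..<p} {..<p}"
    by (rule bij[OF inj2]) (auto simp: s2_def p)
  ultimately have "\<forall>j<3. bij_betw (\<sigma> j) {..<p} {..<p}"
    by (auto simp: \<sigma>_def bij_betw_def inj_on_def)
  moreover have "\<forall>i<p. (\<Sum>j<3. \<sigma> j i) = 3 * q"
    by (auto simp: \<sigma>_def s1_def s2_def p eval_nat_numeral)
  ultimately show ?thesis by blast
qed

lemma kotzig_array_exists:
  fixes m p :: nat
  assumes "m \<noteq> 1" and "even m \<or> odd p"
  shows "\<exists>\<sigma> c. (\<forall>j<m. bij_betw (\<sigma> j) {..<p} {..<p}) \<and> (\<forall>i<p. (\<Sum>j<m. \<sigma> j i) = (c :: nat))"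
  using assms
proof (induction m rule: less_induct)
  case (less m)
  \<comment> \<open>Removing two rows keeps the parity: an even \<open>m\<close> descends to
    \<open>0\<close>, and \<open>l \<noteq> 1\<close> makes an odd \<open>m\<close> stop at
    \<open>3\<close>.\<close>
  consider "m = 0" | "m = 3" | l where "m = Suc (Suc l)" "l \<noteq> 1"
  proof (cases "m = 0 \<or> m = 3")
    case False
    with less.prems(1) have "m = Suc (Suc (m - 2))" "m - 2 \<noteq> 1" by auto
    then show thesis by (rule that(3))
  qed (use that in blast)
  then show ?case
  proof cases
    case 1
    then show ?thesis by auto
  next
    case 2
    then show ?thesis using kotzig_array_3 less.prems by auto
  next
    case 3
    with less.prems(2) less.IH[of l] obtain \<sigma> c where
      s: "\<forall>j<l. bij_betw (\<sigma> j) {..<p} {..<p}" and c: "\<forall>i<p. (\<Sum>j<l. \<sigma> j i) = c"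
      by auto
    define \<tau> where "\<tau> = \<sigma>(l := \<lambda>i. i, Suc l := \<lambda>i. p - Suc i)"
    have id: "bij_betw (\<lambda>i. i) {..<p} {..<p}"
      by (auto simp: bij_betw_def)
    have rv: "bij_betw (\<lambda>i. p - Suc i) {..<p} {..<p}"
      by (rule bij_betw_byWitness[where f' = "\<lambda>i. p - Suc i"]) auto
    have "\<forall>j<m. bij_betw (\<tau> j) {..<p} {..<p}"
      using s id rv 3 by (auto simp: \<tau>_def less_Suc_eq)
    moreover have "(\<Sum>j<m. \<tau> j i) = c + p - 1" if "i < p" for i
    proof -
      have "(\<Sum>j<l. \<tau> j i) = (\<Sum>j<l. \<sigma> j i)"
        by (rule sum.cong) (auto simp: \<tau>_def)
      then show ?thesis using that c 3 by (simp add: \<tau>_def)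
    qed
    ultimately show ?thesis by blast
  qed
qed

text \<open>The blocks become the columns of an array with \<open>m\<close> rows. Row
  \<open>j\<close> receives the labels \<open>j * p + 1, ..., (j + 1) * p\<close> in the order given
  by row \<open>j\<close> of a Kotzig array, so every column has the same sum.\<close>

lemma equipartition_balanced_labelling:
  assumes fin: "finite V" and part: "partition_on V P" and card: "\<And>U. U \<in> P \<Longrightarrow> card U = m"
    and "m \<noteq> 1" and "even m \<or> odd (card P)"
  shows "\<exists>(f :: 'a \<Rightarrow> nat) c. bij_betw f V {1..card V} \<and> (\<forall>U\<in>P. sum f U = c)"
proof -
  define p where "p = card P"
  obtain \<sigma> c where s: "\<And>j. j < m \<Longrightarrow> bij_betw (\<sigma> j) {..<p} {..<p}"
    and c: "\<And>i. i < p \<Longrightarrow> (\<Sum>j<m. \<sigma> j i) = (c :: nat)"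
    using kotzig_array_exists[of m p] assms(4,5) unfolding p_def by blast
  have finP: "finite P"
    using fin part by (rule finite_elements)
  have finU: "finite U" if "U \<in> P" for U
    using fin part that by (metis Union_upper finite_subset partition_on_def)
  obtain g where g: "bij_betw g P {..<p}"
    using finP ex_bij_betw_finite_nat[OF finP] by (auto simp: p_def atLeast0LessThan)
  have "\<forall>U\<in>P. \<exists>h. bij_betw h U {..<m}"
    using ex_bij_betw_finite_nat[OF finU] card by (metis atLeast0LessThan)
  then obtain e where e: "\<And>U. U \<in> P \<Longrightarrow> bij_betw (e U) U {..<m}"
    by metis
  have "\<forall>v\<in>V. \<exists>U. U \<in> P \<and> v \<in> U"
    using part by (auto simp: partition_on_def)
  then obtain B where B: "\<And>v. v \<in> V \<Longrightarrow> B v \<in> P \<and> v \<in> B v"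
    by metis
  have VU: "U \<subseteq> V" if "U \<in> P" for U
    using part that by (auto simp: partition_on_def)
  have BU: "B v = U" if "U \<in> P" "v \<in> U" for U v
    using partition_onD2[OF part] B[of v] VU[OF that(1)] that unfolding disjoint_def by blast
  have cardV: "card V = m * p"
    using product_partition[OF part] finU card
    by (simp add: p_def)
  define row col where "row v = e (B v) v" and "col v = g (B v)" for v
  define f where "f v = row v * p + \<sigma> (row v) (col v) + 1" for v
  have row: "row v < m" if "v \<in> V" for v
    using e[of "B v"] B[OF that] by (auto simp: row_def bij_betw_def)
  have col: "col v < p" if "v \<in> V" for v
    using g B[OF that] by (auto simp: col_def bij_betw_def)
  have sig: "\<sigma> (row v) (col v) < p" if "v \<in> V" for v
    using s[OF row[OF that]] col[OF that] by (auto simp: bij_betw_def)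
  have inj: "inj_on f V"
  proof (rule inj_onI)
    fix u v assume u: "u \<in> V" and v: "v \<in> V" and "f u = f v"
    then have eq: "row u * p + \<sigma> (row u) (col u) = row v * p + \<sigma> (row v) (col v)"
      by (simp add: f_def)
    \<comment> \<open>The permuted entry is below \<open>p\<close>, so division by \<open>p\<close>
      recovers the row.\<close>
    then have "(row u * p + \<sigma> (row u) (col u)) div p = (row v * p + \<sigma> (row v) (col v)) div p"
      by simp
    then have r: "row u = row v"
      using sig[OF u] sig[OF v] by simp
    with eq have "\<sigma> (row u) (col u) = \<sigma> (row u) (col v)" by simp
    with s[OF row[OF u]] col[OF u] col[OF v] have "col u = col v"
      by (auto simp: bij_betw_def dest: inj_onD)
    with g B[OF u] B[OF v] have b: "B u = B v"
      by (auto simp: col_def bij_betw_def dest: inj_onD)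
    with r e[of "B u"] B[OF u] B[OF v] show "u = v"
      by (auto simp: row_def bij_betw_def dest: inj_onD)
  qed
  have "f ` V \<subseteq> {1..card V}"
  proof
    fix y assume "y \<in> f ` V"
    then obtain v where v: "v \<in> V" and y: "y = f v" by auto
    have "f v \<le> Suc (row v) * p"
      using sig[OF v] by (simp add: f_def)
    also have "\<dots> \<le> m * p"
      using row[OF v] by (intro mult_right_mono) auto
    finally show "y \<in> {1..card V}"
      using y cardV by (simp add: f_def)
  qed
  with inj have "bij_betw f V {1..card V}"
    by (metis bij_betw_def card_atLeastAtMost card_image card_subset_eq diff_Suc_1 finite_atLeastAtMost)
  moreover have "sum f U = (\<Sum>j<m. j * p + 1) + c" if U: "U \<in> P" for U
  proof -
    have gU: "g U < p"
      using g U by (auto simp: bij_betw_def)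
    have "sum f U = (\<Sum>v\<in>U. e U v * p + \<sigma> (e U v) (g U) + 1)"
      using BU[OF U] by (intro sum.cong) (auto simp: f_def row_def col_def)
    also have "\<dots> = (\<Sum>j<m. j * p + \<sigma> j (g U) + 1)"
      by (rule sum.reindex_bij_betw[OF e[OF U]])
    also have "\<dots> = (\<Sum>j<m. j * p + 1) + (\<Sum>j<m. \<sigma> j (g U))"
      by (subst sum.distrib[symmetric]) (simp add: algebra_simps)
    finally show ?thesis using c[OF gU] by simp
  qed
  ultimately show ?thesis by blast
qed

section \<open>Strongly regular adjacency relations\<close>

text \<open>The parameters \<open>lam\<close> and \<open>mu\<close> are integers because their
  differences enter the eigenvalue equation. A parameter is unconstrained if no pair of vertices of
  its kind exists.\<close>

locale strongly_regular_adjacency =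
  fixes V :: "'a set" and E :: "'a \<Rightarrow> 'a \<Rightarrow> bool" and r :: nat and lam mu :: int
  assumes finite_V: "finite V"
    and E_in_V: "E u v \<Longrightarrow> u \<in> V \<and> v \<in> V"
    and E_sym: "E u v \<Longrightarrow> E v u"
    and E_irrefl: "\<not> E u u"
    and card_neighbours: "u \<in> V \<Longrightarrow> card {w. E u w} = r"
    and common_adjacent: "E u v \<Longrightarrow> int (card {w. E u w \<and> E v w}) = lam"
    and common_nonadjacent:
      "\<lbrakk>u \<in> V; v \<in> V; u \<noteq> v; \<not> E u v\<rbrakk> \<Longrightarrow> int (card {w. E u w \<and> E v w}) = mu"
begin

lemma neighbours_subset: "{w. E u w} \<subseteq> V"
  using E_in_V by blast

lemma finite_neighbours: "finite {w. E u w}"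
  using neighbours_subset finite_V by (rule finite_subset)

text \<open>
  Reading the hypothesis as \<open>A f = a 1 + e f\<close>, comparing coefficients in
  \<open>A\<^sup>2 = r I + lam A + mu (J - I - A)\<close> shows that \<open>e\<close> satisfies the eigenvalue equation, since
  \<open>f\<close> is not constant.
\<close>

lemma affine_neighbour_sum:
  fixes f :: "'a \<Rightarrow> int"
  assumes inj: "inj_on f V" and "1 < card V"
    and sum: "\<And>x. x \<in> V \<Longrightarrow> (\<Sum>w | E x w. f w) = a + e * f x"
  shows "e * e = int r - mu + (lam - mu) * e"
proof -
  define S where "S = sum f V"
  \<comment> \<open>Equating the two evaluations of \<open>A\<^sup>2 f\<close> at \<open>x\<close>
    and collecting the multiples of \<open>f x\<close> gives \<open>q * f x = C\<close>, where
    \<open>C\<close> does not depend on \<open>x\<close>.\<close>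
  define C where "C = int r * a + e * a - lam * a - mu * (S - a)"
  define q where "q = int r - mu + (lam - mu) * e - e * e"
  have key: "q * f x = C" if x: "x \<in> V" for x
  proof -
    \<comment> \<open>First evaluation: apply the affine relation twice.\<close>
    have "(\<Sum>w | E x w. \<Sum>y | E w y. f y) = (\<Sum>w | E x w. a + e * f w)"
      using E_in_V by (intro sum.cong) (auto simp: sum)
    also have "\<dots> = int r * a + e * (a + e * f x)"
      using x by (simp add: sum.distrib card_neighbours sum flip: sum_distrib_left)
    finally have 1: "(\<Sum>w | E x w. \<Sum>y | E w y. f y) = int r * a + e * (a + e * f x)" .
    \<comment> \<open>Second evaluation: exchange the sums, so that \<open>f y\<close> is weighted
      by the number of common neighbours of \<open>x\<close> and \<open>y\<close>. This weight is
      \<open>r\<close>, \<open>lam\<close> or \<open>mu\<close> according to whether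
      \<open>y\<close> is \<open>x\<close>, a neighbour of \<open>x\<close>, or neither.\<close>
    have "(\<Sum>w | E x w. \<Sum>y | E w y. f y) = (\<Sum>w | E x w. \<Sum>y\<in>{y\<in>V. E w y}. f y)"
      using E_in_V by (intro sum.cong) auto
    also have "\<dots> = (\<Sum>y\<in>V. \<Sum>w\<in>{w \<in> {w. E x w}. E w y}. f y)"
      by (rule sum.swap_restrict[OF finite_neighbours finite_V])
    also have "\<dots> = (\<Sum>y\<in>V. int (card {w. E x w \<and> E y w}) * f y)"
    proof (rule sum.cong[OF refl])
      fix y
      have "{w \<in> {w. E x w}. E w y} = {w. E x w \<and> E y w}"
        using E_sym by auto
      then show "(\<Sum>w\<in>{w \<in> {w. E x w}. E w y}. f y) = int (card {w. E x w \<and> E y w}) * f y"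
        by simp
    qed
    also have "V = {x} \<union> {y. E x y} \<union> (V - {x} - {y. E x y})"
      using x neighbours_subset by auto
    also have "(\<Sum>y\<in>\<dots>. int (card {w. E x w \<and> E y w}) * f y)
        = int (card {w. E x w}) * f x + (\<Sum>y | E x y. lam * f y)
          + (\<Sum>y\<in>V - {x} - {y. E x y}. mu * f y)"
    proof -
      have "(\<Sum>y\<in>V - {x} - {y. E x y}. int (card {w. E x w \<and> E y w}) * f y)
          = (\<Sum>y\<in>V - {x} - {y. E x y}. mu * f y)"
        using x by (intro sum.cong) (auto simp: common_nonadjacent)
      moreover have "(\<Sum>y | E x y. int (card {w. E x w \<and> E y w}) * f y) = (\<Sum>y | E x y. lam * f y)"
        by (intro sum.cong) (auto simp: common_adjacent)
      ultimately show ?thesis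
        using finite_V finite_neighbours E_irrefl
        by (subst sum.union_disjoint; (subst sum.union_disjoint)?) auto
    qed
    also have "(\<Sum>y\<in>V - {x} - {y. E x y}. mu * f y) = mu * (S - f x - (a + e * f x))"
    proof -
      have "(\<Sum>y\<in>V - {x} - {y. E x y}. f y) = (\<Sum>y\<in>V - {x}. f y) - (\<Sum>y | E x y. f y)"
        using E_irrefl E_in_V finite_V by (intro sum_diff) auto
      then show ?thesis
        using x finite_V by (simp add: S_def sum sum_diff1 flip: sum_distrib_left)
    qed
    finally have "(\<Sum>w | E x w. \<Sum>y | E w y. f y)
        = int r * f x + lam * (a + e * f x) + mu * (S - f x - (a + e * f x))"
      using x by (simp add: card_neighbours sum flip: sum_distrib_left)
    with 1 show ?thesis
      by (simp add: q_def C_def algebra_simps)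
  qed
  obtain x y where "x \<in> V" "y \<in> V" "x \<noteq> y"
    using \<open>1 < card V\<close> by (metis card_le_Suc0_iff_eq finite_V not_le One_nat_def)
  with key inj have "q = 0"
    by (metis inj_onD mult_left_cancel)
  then show ?thesis by (simp add: q_def)
qed

text \<open>Nonadjacent \<open>u\<close> and \<open>v\<close> would have a common neighbour
  \<open>w\<close> because \<open>mu\<close> is positive. As \<open>lam\<close> is maximal,
  \<open>u\<close> is adjacent to every other neighbour of \<open>w\<close>, and \<open>v\<close> is
  one of them.\<close>

lemma complete_if_common_maximal:
  assumes "lam = int r - 1" and "0 < mu" and u: "u \<in> V" and v: "v \<in> V" and "u \<noteq> v"
  shows "E u v"
proof (rule ccontr)
  assume n: "\<not> E u v"
  with assms common_nonadjacent[OF u v] have "{w. E u w \<and> E v w} \<noteq> {}"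
    by force
  then obtain w where w: "E u w" "E v w" by auto
  have "card ({z. E w z} - {u}) = r - 1"
    using w E_sym E_in_V finite_neighbours by (simp add: card_neighbours)
  moreover have "card {z. E w z \<and> E u z} = r - 1"
    using common_adjacent[of w u] w E_sym assms(1) by force
  moreover have "{z. E w z \<and> E u z} \<subseteq> {z. E w z} - {u}"
    using E_irrefl by auto
  ultimately have "{z. E w z \<and> E u z} = {z. E w z} - {u}"
    using finite_neighbours by (intro card_subset_eq) auto
  with w E_sym n \<open>u \<noteq> v\<close> show False by blast
qed

lemma neighbours_eq_if_nonadjacent:
  assumes "mu = int r" and u: "u \<in> V" and v: "v \<in> V" and n: "\<not> E u v"
  shows "{w. E u w} = {w. E v w}"
proof (cases "u = v")
  case False
  then have "card {w. E u w \<and> E v w} = r"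
    using common_nonadjacent[OF u v _ n] assms(1) by simp
  then have "{w. E u w \<and> E v w} = {w. E u w}" "{w. E u w \<and> E v w} = {w. E v w}"
    using u v finite_neighbours
    by (intro card_subset_eq; force simp: card_neighbours)+
  then show ?thesis by simp
qed simp

text \<open>Nonadjacent vertices have equal neighbourhoods, so nonadjacency is an equivalence
  relation. Its classes are the complements of the neighbourhoods.\<close>

lemma nonadjacency_partition:
  assumes "mu = int r"
  defines "P \<equiv> (\<lambda>u. {v \<in> V. \<not> E u v}) ` V"
  shows "partition_on V P"
    and "\<And>U. U \<in> P \<Longrightarrow> card U = card V - r"
    and "\<And>u v. E u v \<longleftrightarrow> u \<in> V \<and> v \<in> V \<and> \<not> (\<exists>U\<in>P. u \<in> U \<and> v \<in> U)"
proof -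
  have eq: "E u w \<longleftrightarrow> E v w" if "u \<in> V" "v \<in> V" "\<not> E u v" for u v w
    using neighbours_eq_if_nonadjacent[OF assms(1) that] by auto
  show "partition_on V P"
  proof (rule partition_onI)
    show "\<Union>P = V"
      using E_irrefl by (auto simp: P_def)
    show "{} \<notin> P"
      using E_irrefl by (auto simp: P_def)
    fix U W assume "U \<in> P" "W \<in> P" "U \<noteq> W"
    then obtain u w where uw: "u \<in> V" "w \<in> V" "U = {v \<in> V. \<not> E u v}" "W = {v \<in> V. \<not> E w v}"
      by (auto simp: P_def)
    show "disjnt U W"
    proof (rule ccontr)
      assume "\<not> disjnt U W"
      then obtain v where "v \<in> V" "\<not> E u v" "\<not> E w v"
        using uw by (auto simp: disjnt_def)
      then have "E u x \<longleftrightarrow> E w x" for x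
        using eq[of u v x] eq[of w v x] uw(1,2) by blast
      with uw \<open>U \<noteq> W\<close> show False by simp
    qed
  qed
  show "card U = card V - r" if "U \<in> P" for U
  proof -
    from that obtain u where u: "u \<in> V" "U = V - {v. E u v}" by (auto simp: P_def)
    then show ?thesis
      using card_Diff_subset[OF finite_neighbours neighbours_subset] by (simp add: card_neighbours)
  qed
  show "E u v \<longleftrightarrow> u \<in> V \<and> v \<in> V \<and> \<not> (\<exists>U\<in>P. u \<in> U \<and> v \<in> U)" for u v
  proof
    assume "E u v"
    then show "u \<in> V \<and> v \<in> V \<and> \<not> (\<exists>U\<in>P. u \<in> U \<and> v \<in> U)"
      using eq[of _ u v] E_in_V E_sym unfolding P_def by blast
  next
    assume "u \<in> V \<and> v \<in> V \<and> \<not> (\<exists>U\<in>P. u \<in> U \<and> v \<in> U)"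
    then show "E u v"
      using E_irrefl by (auto simp: P_def)
  qed
qed

end

section \<open>Distances and magic labellings\<close>

context wf_digraph
begin

lemma awalk_cost_unit: "awalk_cost (\<lambda>_. 1) p = real (length p)"
  by (induction p) auto

text \<open>Walk lengths are natural numbers, so the infimum is attained as soon as a walk exists;
  the infimum of the empty set is \<open>\<infinity>\<close>.\<close>

lemma graph_dist_eq_iff:
  "graph_dist G u v = ereal (real i) \<longleftrightarrow>
     (\<exists>p. awalk u p v \<and> length p = i) \<and> (\<forall>p. awalk u p v \<longrightarrow> i \<le> length p)"
  and graph_dist_cases: "graph_dist G u v = \<infinity> \<or> (\<exists>i. graph_dist G u v = ereal (real i))"
proof -
  have inf: "graph_dist G u v = (INF p\<in>{p. awalk u p v}. ereal (real (length p)))"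
    by (simp add: graph_dist_def \<mu>_def awalk_cost_unit)
  have min: "graph_dist G u v = ereal (real j)"
    if "awalk u q v" "length q = j" "\<And>p. awalk u p v \<Longrightarrow> j \<le> length p" for q j
    unfolding inf using that by (intro INF_eqI) auto
  have ex: "\<exists>q. awalk u q v \<and> (\<forall>p. awalk u p v \<longrightarrow> length q \<le> length p)" if "awalk u p v" for p
    using ex_has_least_nat[of "\<lambda>p. awalk u p v" p length] that by blast
  show "graph_dist G u v = \<infinity> \<or> (\<exists>i. graph_dist G u v = ereal (real i))"
  proof (cases "\<exists>p. awalk u p v")
    case True
    with ex min show ?thesis by blast
  next
    case False
    then show ?thesis by (simp add: inf top_ereal_def)
  qed
  show "graph_dist G u v = ereal (real i) \<longleftrightarrow>
     (\<exists>p. awalk u p v \<and> length p = i) \<and> (\<forall>p. awalk u p v \<longrightarrow> i \<le> length p)"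
  proof
    assume d: "graph_dist G u v = ereal (real i)"
    then have "\<exists>p. awalk u p v"
      by (auto simp: inf top_ereal_def intro: ccontr)
    then obtain q where q: "awalk u q v" "\<And>p. awalk u p v \<Longrightarrow> length q \<le> length p"
      using ex by blast
    with min[OF q(1) refl] d have "length q = i" by simp
    with q show "(\<exists>p. awalk u p v \<and> length p = i) \<and> (\<forall>p. awalk u p v \<longrightarrow> i \<le> length p)"
      by blast
  qed (use min in blast)
qed

lemma graph_dist_0_iff: "graph_dist G u v = ereal 0 \<longleftrightarrow> u = v \<and> u \<in> verts G"
  using graph_dist_eq_iff[of u v 0] by (auto simp: awalk_Nil_iff)

text \<open>The condition \<open>u \<noteq> v\<close> is there because a \<open>wf_digraph\<close>
  may have loops, and the distance from a vertex to itself is \<open>0\<close>.\<close>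

lemma graph_dist_1_iff: "graph_dist G u v = ereal 1 \<longleftrightarrow> u \<rightarrow> v \<and> u \<noteq> v"
proof -
  have "(\<exists>p. awalk u p v \<and> length p = 1) \<longleftrightarrow> u \<rightarrow> v"
    by (auto simp: length_Suc_conv awalk_simps arcs_ends_conv intro: exI[of _ "[_]"])
      (metis awalk_Cons_iff awalk_Nil_iff head_in_verts length_Cons list.size(3) One_nat_def)
  moreover have "(\<forall>p. awalk u p v \<longrightarrow> 1 \<le> length p) \<longleftrightarrow> \<not> (u = v \<and> u \<in> verts G)"
    by (metis One_nat_def Suc_leI awalk_Nil_iff length_greater_0_conv list.size(3) not_one_le_zero)
  ultimately show ?thesis
    using graph_dist_eq_iff[of u v 1] adj_in_verts by auto
qed

end

lemma (in digraph) card_neighbours_eq_out_degree: "card {w. u \<rightarrow> w} = out_degree G u"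
proof -
  have "{w. u \<rightarrow> w} = head G ` out_arcs G u"
    by (auto simp: arcs_ends_conv)
  moreover have "inj_on (head G) (out_arcs G u)"
    using no_multi_arcs by (auto simp: inj_on_def arc_to_ends_def)
  ultimately show ?thesis
    by (simp add: out_degree_def card_image)
qed

section \<open>Complementary distance sets\<close>

lemma sum_D_neighbourhood_complement:
  assumes "finite (verts G)" and "D \<subseteq> {0, 1, 2}" and x: "x \<in> verts G"
    and dist: "\<And>y. y \<in> verts G \<Longrightarrow> graph_dist G x y \<in> {ereal 0, ereal 1, ereal 2}"
  shows "sum f (D_neighbourhood G D x) + sum f (D_neighbourhood G ({0, 1, 2} - D) x) = sum f (verts G)"
proof -
  have "D_neighbourhood G D x \<union> D_neighbourhood G ({0, 1, 2} - D) x = verts G"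
    using dist unfolding D_neighbourhood_def by fastforce
  moreover have "D_neighbourhood G D x \<inter> D_neighbourhood G ({0, 1, 2} - D) x = {}"
    by (auto simp: D_neighbourhood_def)
  moreover have "finite (D_neighbourhood G A x)" for A
    using assms(1) by (auto simp: D_neighbourhood_def)
  ultimately show ?thesis
    by (metis sum.union_disjoint)
qed

text \<open>The neighbourhoods for \<open>D\<close> and for its complement partition the vertex set,
  so the same labelling serves both, with constants adding up to the sum of all labels.\<close>

lemma D_magic_complement:
  fixes G :: "('a,'b) pre_digraph"
  assumes "finite (verts G)" and D: "D \<subseteq> {0, 1, 2}"
    and dist: "\<And>x y. \<lbrakk>x \<in> verts G; y \<in> verts G\<rbrakk> \<Longrightarrow> graph_dist G x y \<in> {ereal 0, ereal 1, ereal 2}"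
  shows "D_magic G ({0, 1, 2} - D) \<longleftrightarrow> D_magic G D"
proof -
  have imp: "D_magic G ({0, 1, 2} - A)" if "A \<subseteq> {0, 1, 2}" "D_magic G A" for A
  proof -
    from that(2) obtain f :: "'a \<Rightarrow> nat" and k where f: "bij_betw f (verts G) {1..card (verts G)}"
      and k: "\<forall>x\<in>verts G. sum f (D_neighbourhood G A x) = k"
      unfolding D_magic_def by blast
    have "sum f (D_neighbourhood G ({0, 1, 2} - A) x) = sum f (verts G) - k" if "x \<in> verts G" for x
      using sum_D_neighbourhood_complement[OF assms(1) \<open>A \<subseteq> _\<close> that dist[OF that], of f] k that by force
    with f show ?thesis
      unfolding D_magic_def by blast
  qed
  have "{0, 1, 2} - ({0, 1, 2} - D) = D"
    using D by blast
  then show ?thesis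
    using imp[OF D] imp[of "{0, 1, 2} - D"] by auto
qed

text \<open>Counting vertices part by part shows that, for positive \<open>m\<close>, the quotient
  is exact and equals the number of parts.\<close>

lemma complete_multipartite_graphI:
  assumes "graph G" and "partition_on (verts G) P" and "\<And>U. U \<in> P \<Longrightarrow> card U = m" and "0 < m"
    and "\<And>u v. u \<rightarrow>\<^bsub>G\<^esub> v \<longleftrightarrow> u \<in> verts G \<and> v \<in> verts G \<and> \<not> (\<exists>U\<in>P. u \<in> U \<and> v \<in> U)"
  shows "complete_multipartite_graph m (card (verts G) div m) G"
proof -
  interpret graph G by fact
  have "finite U" if "U \<in> P" for U
    using assms(2) that finite_verts by (metis Union_upper finite_subset partition_on_def)
  then have "card (verts G) = card P * m"
    using product_partition[OF assms(2)] assms(3)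
    by (simp add: mult.commute)
  with assms show ?thesis
    unfolding complete_multipartite_graph_def by auto
qed

section \<open>Distances and intersection numbers of strongly regular graphs\<close>

locale strongly_regular_graph =
  fixes G :: "('a,'b) pre_digraph" (structure) and r :: nat
  assumes strongly_regular: "strongly_regular G r"
begin

sublocale graph G
  using strongly_regular by (auto simp: strongly_regular_def distance_regular_def)

lemma degree_pos: "0 < r"
  using strongly_regular by (auto simp: strongly_regular_def distance_regular_def)

lemma adj_sym: "u \<rightarrow> v \<Longrightarrow> v \<rightarrow> u"
  using sym_arcs by (rule arcs_ends_symmetric)

lemma adj_irrefl: "\<not> u \<rightarrow> u"
  using adj_not_same by blast

lemma card_adj: "u \<in> verts G \<Longrightarrow> card {w. u \<rightarrow> w} = r"
  using strongly_regular
  by (auto simp: strongly_regular_def distance_regular_def card_neighbours_eq_out_degree)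

lemma dist_cases:
  assumes u: "u \<in> verts G" and v: "v \<in> verts G"
  shows "graph_dist G u v \<in> {ereal 0, ereal 1, ereal 2}"
proof -
  obtain d where "d \<le> 2" and d: "graph_diameter G = ereal (real d)"
    using strongly_regular by (auto simp: strongly_regular_def distance_regular_def)
  have "graph_dist G u v \<le> graph_diameter G"
    unfolding graph_diameter_def using u v by (meson SUP_upper2 SUP_upper)
  with d graph_dist_cases[of u v] obtain i where i: "graph_dist G u v = ereal (real i)" "i \<le> d"
    by auto
  with \<open>d \<le> 2\<close> have "i = 0 \<or> i = 1 \<or> i = 2"
    by linarith
  with i show ?thesis by auto
qed

lemma dist_2_iff:
  assumes "u \<in> verts G" and "v \<in> verts G"
  shows "graph_dist G u v = ereal 2 \<longleftrightarrow> u \<noteq> v \<and> \<not> u \<rightarrow> v"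
  using dist_cases[OF assms] graph_dist_0_iff[of u v] graph_dist_1_iff[of u v] assms adj_irrefl
  by auto

lemma D_neighbourhood_0: "x \<in> verts G \<Longrightarrow> D_neighbourhood G {0} x = {x}"
  using graph_dist_0_iff by (auto simp: D_neighbourhood_def)

lemma D_neighbourhood_1: "D_neighbourhood G {1} x = {w. x \<rightarrow> w}"
  using graph_dist_1_iff adj_in_verts adj_irrefl by (auto simp: D_neighbourhood_def)

lemma D_neighbourhood_2:
  "x \<in> verts G \<Longrightarrow> D_neighbourhood G {2} x = verts G - {x} - {w. x \<rightarrow> w}"
  using dist_2_iff by (auto simp: D_neighbourhood_def)

text \<open>In diameter \<open>2\<close> the parameters are \<open>lam = r - 1 - b 1\<close> and
  \<open>mu = c 2\<close>. Positivity of \<open>mu\<close> is recorded for the completeness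
  criterion.\<close>

lemma ex_intersection_numbers:
  "\<exists>lam mu. strongly_regular_adjacency (verts G) (dominates G) r lam mu \<and> 0 < mu"
proof -
  obtain d b c where "d \<le> 2" and diam: "graph_diameter G = ereal (real d)"
    and c_pos: "\<And>i. i \<in> {1..d} \<Longrightarrow> 0 < (c i :: nat)"
    and c: "\<And>u v i. \<lbrakk>u \<in> verts G; v \<in> verts G; graph_dist G u v = ereal (real i); 1 \<le> i; i \<le> d\<rbrakk> \<Longrightarrow>
      card {w \<in> verts G. u \<rightarrow> w \<and> graph_dist G w v = ereal (real (i - 1))} = c i"
    and b: "\<And>u v i. \<lbrakk>u \<in> verts G; v \<in> verts G; graph_dist G u v = ereal (real i); i < d\<rbrakk> \<Longrightarrow>
      card {w \<in> verts G. u \<rightarrow> w \<and> graph_dist G w v = ereal (real (i + 1))} = (b i :: nat)"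
    using strongly_regular unfolding strongly_regular_def distance_regular_def by blast
  have le_d: "i \<le> d" if "u \<in> verts G" "v \<in> verts G" "graph_dist G u v = ereal (real i)" for u v i
  proof -
    have "graph_dist G u v \<le> graph_diameter G"
      unfolding graph_diameter_def using that by (meson SUP_upper2 SUP_upper)
    with that diam show ?thesis by simp
  qed
  \<comment> \<open>\<open>\<beta>\<close> counts the neighbours of \<open>u\<close> at distance
    \<open>2\<close> from an adjacent \<open>v\<close>; there are none if the diameter is less than
    \<open>2\<close>.\<close>
  define \<beta> where "\<beta> = (if d = 2 then b 1 else 0)"
  have adjacent: "int (card {w. u \<rightarrow> w \<and> v \<rightarrow> w}) = int r - 1 - int \<beta>" if uv: "u \<rightarrow> v" for u v
  proof -
    have V: "u \<in> verts G" "v \<in> verts G" using uv adj_in_verts by auto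
    let ?A = "{w \<in> verts G. u \<rightarrow> w \<and> graph_dist G w v = ereal 2}"
    have d1: "graph_dist G u v = ereal 1"
      using uv adj_irrefl graph_dist_1_iff by auto
    have "card ?A = \<beta>"
    proof (cases "d = 2")
      case True
      then show ?thesis using b[of u v 1] d1 V by (simp add: \<beta>_def)
    next
      case False
      with \<open>d \<le> 2\<close> have "?A = {}"
        using le_d[of _ v 2] V by force
      then show ?thesis using False by (simp only: \<beta>_def card.empty if_False)
    qed
    moreover have "card ({w. u \<rightarrow> w \<and> v \<rightarrow> w} \<union> ?A) = card {w. u \<rightarrow> w \<and> v \<rightarrow> w} + card ?A"
    proof (rule card_Un_disjoint)
      show "finite {w. u \<rightarrow> w \<and> v \<rightarrow> w}"
        using adj_in_verts by (intro finite_subset[OF _ finite_verts]) auto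
      show "{w. u \<rightarrow> w \<and> v \<rightarrow> w} \<inter> ?A = {}"
        using dist_2_iff[OF _ V(2)] adj_sym by auto
    qed simp
    moreover have "{w. u \<rightarrow> w \<and> v \<rightarrow> w} \<union> ?A = {w. u \<rightarrow> w} - {v}"
      using uv dist_2_iff[OF _ V(2)] adj_in_verts adj_sym adj_irrefl by auto
    moreover have "card ({w. u \<rightarrow> w} - {v}) = r - 1"
      using uv card_adj[OF V(1)] by simp
    ultimately have "card {w. u \<rightarrow> w \<and> v \<rightarrow> w} + \<beta> = r - 1" by simp
    then show ?thesis using degree_pos by simp
  qed
  \<comment> \<open>If the diameter is less than \<open>2\<close>, distinct nonadjacent vertices do
    not exist, and \<open>1\<close> is merely a positive default.\<close>
  define \<mu> where "\<mu> = (if d = 2 then c 2 else 1)"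
  have nonadjacent: "int (card {w. u \<rightarrow> w \<and> v \<rightarrow> w}) = int \<mu>"
    if V: "u \<in> verts G" "v \<in> verts G" and n: "u \<noteq> v" "\<not> u \<rightarrow> v" for u v
  proof -
    have d2: "graph_dist G u v = ereal 2"
      using V n dist_2_iff by simp
    then have "d = 2"
      using le_d[OF V, of 2] \<open>d \<le> 2\<close> by simp
    moreover have "{w \<in> verts G. u \<rightarrow> w \<and> graph_dist G w v = ereal 1} = {w. u \<rightarrow> w \<and> v \<rightarrow> w}"
      using graph_dist_1_iff adj_in_verts adj_sym adj_irrefl by auto
    ultimately show ?thesis
      using c[OF V, of 2] d2 by (simp add: \<mu>_def)
  qed
  have "strongly_regular_adjacency (verts G) (dominates G) r (int r - 1 - int \<beta>) (int \<mu>)"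
    by unfold_locales (use adj_in_verts adj_sym adj_irrefl card_adj adjacent nonadjacent in auto)
  moreover have "0 < int \<mu>"
    using c_pos[of 2] by (auto simp: \<mu>_def)
  ultimately show ?thesis by blast
qed

lemma card_verts_gt_1: "1 < card (verts G)" and degree_less: "r < card (verts G)"
proof -
  obtain d where d: "graph_diameter G = ereal (real d)"
    using strongly_regular by (auto simp: strongly_regular_def distance_regular_def)
  \<comment> \<open>Without vertices the diameter would be the supremum of the empty set,
    \<open>-\<infinity>\<close>, and not a natural number.\<close>
  have "verts G \<noteq> {}"
    using d by (auto simp: graph_diameter_def bot_ereal_def)
  then obtain u where u: "u \<in> verts G" by auto
  have "{w. u \<rightarrow> w} \<subset> verts G"
    using adj_in_verts adj_irrefl[of u] u by blast
  then show "r < card (verts G)"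
    using psubset_card_mono[OF finite_verts] card_adj[OF u] by metis
  then show "1 < card (verts G)"
    using degree_pos by simp
qed

section \<open>Magic labellings for the distance sets \<open>{}\<close>, \<open>{0}\<close>,
  \<open>{2}\<close> and \<open>{1}\<close>\<close>

lemma not_constant_labelling:
  assumes "bij_betw f (verts G) B" and "\<forall>x\<in>verts G. f x = k"
  shows False
proof -
  obtain x y where "x \<in> verts G" "y \<in> verts G" "x \<noteq> y"
    using card_verts_gt_1 by (metis card_le_Suc0_iff_eq finite_verts not_le One_nat_def)
  with assms show False by (metis bij_betw_def inj_onD)
qed

lemma not_D_magic_0: "\<not> D_magic G {0}"
proof
  assume "D_magic G {0}"
  then obtain f :: "'a \<Rightarrow> nat" and k where "bij_betw f (verts G) {1..card (verts G)}"
    and "\<forall>x\<in>verts G. sum f (D_neighbourhood G {0} x) = k"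
    unfolding D_magic_def by blast
  then show False
    using not_constant_labelling by (simp add: D_neighbourhood_0)
qed

lemma D_magic_empty: "D_magic G {}"
proof -
  obtain f where "bij_betw f (verts G) {0..<card (verts G)}"
    using ex_bij_betw_finite_nat[OF finite_verts] by blast
  moreover have "bij_betw Suc {0..<card (verts G)} {1..card (verts G)}"
    by (auto simp: bij_betw_def image_Suc_atLeastLessThan atLeastLessThanSuc_atLeastAtMost)
  ultimately have "bij_betw (Suc \<circ> f) (verts G) {1..card (verts G)}"
    by (rule bij_betw_trans)
  then show ?thesis
    unfolding D_magic_def D_neighbourhood_def by auto
qed

lemma D_magic_2_iff: "D_magic G {2} \<longleftrightarrow> complete_digraph (card (verts G)) G"
proof
  assume "D_magic G {2}"
  then obtain f :: "'a \<Rightarrow> nat" and k where f: "bij_betw f (verts G) {1..card (verts G)}"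
    and k: "\<And>x. x \<in> verts G \<Longrightarrow> sum f (verts G - {x} - {w. x \<rightarrow> w}) = k"
    by (auto simp: D_magic_def D_neighbourhood_2)
  obtain lam mu where "strongly_regular_adjacency (verts G) (dominates G) r lam mu" and mu: "0 < mu"
    using ex_intersection_numbers by blast
  then interpret srg: strongly_regular_adjacency "verts G" "dominates G" r lam mu by simp
  \<comment> \<open>The neighbours of \<open>x\<close> carry all labels except \<open>f x\<close>
    and the constant sum at distance \<open>2\<close>, so \<open>e = -1\<close>.\<close>
  have "(\<Sum>w | x \<rightarrow> w. int (f w)) = (int (sum f (verts G)) - int k) + (- 1) * int (f x)"
    if x: "x \<in> verts G" for x
  proof -
    have "sum f (verts G) = f x + sum f (verts G - {x})"
      using x finite_verts by (simp add: sum.remove)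
    also have "sum f (verts G - {x}) = sum f (verts G - {x} - {w. x \<rightarrow> w}) + sum f {w. x \<rightarrow> w}"
      using adj_in_verts adj_irrefl finite_verts by (intro sum.subset_diff) auto
    finally show ?thesis using k[OF x] by simp
  qed
  \<comment> \<open>At \<open>e = -1\<close> the terms in \<open>mu\<close> cancel, leaving
    \<open>1 = r - lam\<close>.\<close>
  from srg.affine_neighbour_sum[OF _ card_verts_gt_1 this] f
  have "lam = int r - 1"
    by (auto simp: bij_betw_def inj_on_def)
  then have "u \<rightarrow> v" if "u \<in> verts G" "v \<in> verts G" "u \<noteq> v" for u v
    using srg.complete_if_common_maximal mu that by blast
  then show "complete_digraph (card (verts G)) G"
    using adj_in_verts adj_irrefl graph_axioms unfolding complete_digraph_def by blast
next
  assume "complete_digraph (card (verts G)) G"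
  \<comment> \<open>In a complete graph the set \<open>{2}\<close> has the same neighbourhoods as
    \<open>{}\<close>, for which every labelling is magic with constant \<open>0\<close>.\<close>
  then have "D_neighbourhood G {2} x = {}" if "x \<in> verts G" for x
    using that by (auto simp: D_neighbourhood_2 complete_digraph_def)
  moreover have "D_neighbourhood G {} x = {}" for x
    by (simp add: D_neighbourhood_def)
  ultimately show "D_magic G {2}"
    using D_magic_empty by (simp add: D_magic_def)
qed

text \<open>The eigenvalue equation at \<open>e = 0\<close> yields the multipartite structure. The
  conditions on \<open>m\<close> and \<open>p\<close> then come from the equal label sums of the
  parts.\<close>

lemma D_magic_1_imp:
  assumes "D_magic G {1}"
  defines "m \<equiv> card (verts G) - r"
  defines "p \<equiv> card (verts G) div m"
  shows "1 < m" and "complete_multipartite_graph m p G" and "even m \<or> odd p"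
proof -
  obtain f :: "'a \<Rightarrow> nat" and k where f: "bij_betw f (verts G) {1..card (verts G)}"
    and k: "\<And>x. x \<in> verts G \<Longrightarrow> sum f {w. x \<rightarrow> w} = k"
    using assms(1) by (auto simp only: D_magic_def D_neighbourhood_1)
  obtain lam mu where "strongly_regular_adjacency (verts G) (dominates G) r lam mu"
    using ex_intersection_numbers by blast
  then interpret srg: strongly_regular_adjacency "verts G" "dominates G" r lam mu .
  have "(\<Sum>w | x \<rightarrow> w. int (f w)) = int k + 0 * int (f x)" if "x \<in> verts G" for x
    using k[OF that] by (simp flip: of_nat_sum)
  from srg.affine_neighbour_sum[OF _ card_verts_gt_1 this] f
  have mu: "mu = int r"
    by (auto simp: bij_betw_def inj_on_def)
  define P where "P = (\<lambda>u. {v \<in> verts G. \<not> u \<rightarrow> v}) ` verts G"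
  note part = srg.nonadjacency_partition[OF mu, folded P_def m_def]
  have "m \<noteq> 0" using degree_less by (simp add: m_def)
  with part graph_axioms show "complete_multipartite_graph m p G"
    unfolding p_def by (intro complete_multipartite_graphI) auto
  \<comment> \<open>A part is the complement of the neighbourhood of any of its vertices.\<close>
  have split: "sum f U = sum f (verts G) - k" if "U \<in> P" for U
  proof -
    from that obtain u where u: "u \<in> verts G" "U = verts G - {v. u \<rightarrow> v}"
      by (auto simp: P_def)
    with k[OF u(1)] sum.subset_diff[OF srg.neighbours_subset[of u] finite_verts, of f]
    show ?thesis by simp
  qed
  show "1 < m"
  proof (rule ccontr)
    assume "\<not> 1 < m"
    with \<open>m \<noteq> 0\<close> have "m = 1" by simp
    \<comment> \<open>With singleton parts, equal part sums would make the labelling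
      constant.\<close>
    have "f x = sum f (verts G) - k" if x: "x \<in> verts G" for x
    proof -
      let ?U = "{v \<in> verts G. \<not> x \<rightarrow> v}"
      have U: "?U \<in> P" using x by (auto simp: P_def)
      with part(2) \<open>m = 1\<close> have "card ?U = 1" by simp
      moreover have "x \<in> ?U" using x adj_irrefl by simp
      ultimately have "?U = {x}" by (metis card_1_singletonE singletonD)
      with split[OF U] show ?thesis by simp
    qed
    then show False by (blast intro: not_constant_labelling[OF f])
  qed
  have fin: "finite U" if "U \<in> P" for U
    using part(1) that finite_verts by (metis Union_upper finite_subset partition_on_def)
  have n: "card (verts G) = m * card P"
    using product_partition[OF part(1) fin] part(2) by simp
  then have "card P = p" using \<open>m \<noteq> 0\<close> by (simp add: p_def)
  \<comment> \<open>The sum \<open>1 + ... + m * p\<close> of all labels is \<open>p * s\<close>.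
    Cancelling \<open>p\<close> leaves \<open>2 * s = m * (m * p + 1)\<close>, which is impossible
    for odd \<open>m\<close> and even \<open>p\<close>.\<close>
  define s where "s = sum f (verts G) - k"
  have "sum f (verts G) = sum f (\<Union>P)"
    using part(1) by (simp add: partition_on_def)
  also have "\<dots> = (\<Sum>U\<in>P. sum f U)"
    using part(1) fin by (subst sum.Union_disjoint) (auto simp: partition_on_def disjoint_def)
  also have "\<dots> = p * s"
    using split by (simp add: s_def \<open>card P = p\<close>)
  finally have "sum f (verts G) = p * s" .
  moreover have "sum f (verts G) = \<Sum>{1..m * p}"
    using sum.reindex_bij_betw[OF f, of "\<lambda>i. i"] n \<open>card P = p\<close> by simp
  moreover have "2 * \<Sum>{1..m * p} = m * p * (m * p + 1)"
    using double_gauss_sum_from_Suc_0[of "m * p", where ?'a = nat] by simp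
  ultimately have "p * (2 * s) = p * (m * (m * p + 1))"
    by (simp add: algebra_simps)
  moreover have "p \<noteq> 0"
    using n \<open>card P = p\<close> card_verts_gt_1 by (metis mult_0_right not_less_zero)
  ultimately have "2 * s = m * (m * p + 1)" by simp
  then have "even (m * (m * p + 1))" by (metis dvd_triv_left)
  then show "even m \<or> odd p" by auto
qed

text \<open>The neighbourhood of a vertex is the complement of its part, so a labelling with
  constant part sums is magic.\<close>

lemma D_magic_1_if_multipartite:
  assumes "complete_multipartite_graph m p G" and "m \<noteq> 1" and "even m \<or> odd p"
  shows "D_magic G {1}"
proof -
  obtain P where P: "partition_on (verts G) P" "card P = p" "\<And>U. U \<in> P \<Longrightarrow> card U = m"
    and E: "arcs_ends G = {(u,v). u \<in> verts G \<and> v \<in> verts G \<and> \<not> (\<exists>U\<in>P. u \<in> U \<and> v \<in> U)}"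
    using assms(1) by (auto simp: complete_multipartite_graph_def)
  obtain f :: "'a \<Rightarrow> nat" and c where f: "bij_betw f (verts G) {1..card (verts G)}"
    and c: "\<And>U. U \<in> P \<Longrightarrow> sum f U = c"
    using equipartition_balanced_labelling[OF finite_verts P(1,3) assms(2)] assms(3) P(2) by blast
  have "sum f {w. x \<rightarrow> w} = sum f (verts G) - c" if x: "x \<in> verts G" for x
  proof -
    obtain U where U: "U \<in> P" "x \<in> U"
      using P(1) x by (auto simp: partition_on_def)
    then have "{w. x \<rightarrow> w} = verts G - U"
      using x partition_onD2[OF P(1)] unfolding E disjoint_def by blast
    moreover have "U \<subseteq> verts G"
      using P(1) U by (auto simp: partition_on_def)
    ultimately show ?thesis
      using c[OF U(1)] sum.subset_diff[of U "verts G" f] finite_verts by simp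
  qed
  with f show ?thesis
    unfolding D_magic_def D_neighbourhood_1 by blast
qed

lemma D_magic_1_iff:
  "D_magic G {1} \<longleftrightarrow> 1 < card (verts G) - r \<and>
     complete_multipartite_graph (card (verts G) - r) (card (verts G) div (card (verts G) - r)) G \<and>
     (even (card (verts G) - r) \<or>
      odd (card (verts G) - r) \<and> odd (card (verts G) div (card (verts G) - r)))"
proof
  assume "D_magic G {1}"
  from D_magic_1_imp[OF this] show "1 < card (verts G) - r \<and>
     complete_multipartite_graph (card (verts G) - r) (card (verts G) div (card (verts G) - r)) G \<and>
     (even (card (verts G) - r) \<or>
      odd (card (verts G) - r) \<and> odd (card (verts G) div (card (verts G) - r)))"
    by blast
next
  assume *: "1 < card (verts G) - r \<and>
     complete_multipartite_graph (card (verts G) - r) (card (verts G) div (card (verts G) - r)) G \<and>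
     (even (card (verts G) - r) \<or>
      odd (card (verts G) - r) \<and> odd (card (verts G) div (card (verts G) - r)))"
  then have "card (verts G) - r \<noteq> 1" by linarith
  with * show "D_magic G {1}"
    using D_magic_1_if_multipartite by blast
qed

end

text \<open>The empty \<open>D\<close> is excluded because it is always magic. The condition
  \<open>1 < n - r\<close> excludes the degenerate case of singleton parts: a complete graph of odd
  order satisfies the parity condition but is not magic for \<open>{1}\<close> or
  \<open>{0, 2}\<close>.\<close>

theorem theorem7:
  fixes G :: "('a,'b) pre_digraph" and D :: "nat set" and r n :: nat
  assumes "strongly_regular G r"
    and "n = card (verts G)"
    and "D \<subseteq> {0, 1, 2}"
    and "D \<noteq> {}"
  shows "D_magic G D \<longleftrightarrow>
      (D = {0, 1} \<and> complete_digraph n G) \<or>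
      (D = {0, 2} \<and> 1 < n - r \<and> complete_multipartite_graph (n - r) (n div (n - r)) G \<and>
         (even (n - r) \<or> odd (n - r) \<and> odd (n div (n - r)))) \<or>
      D = {0, 1, 2} \<or>
      (D = {1} \<and> 1 < n - r \<and> complete_multipartite_graph (n - r) (n div (n - r)) G \<and>
         (even (n - r) \<or> odd (n - r) \<and> odd (n div (n - r)))) \<or>
      (D = {2} \<and> complete_digraph n G)"
proof -
  interpret strongly_regular_graph G r
    using assms(1) by unfold_locales
  have compl: "D_magic G ({0, 1, 2} - A) \<longleftrightarrow> D_magic G A" if "A \<subseteq> {0, 1, 2}" for A
    using D_magic_complement[OF finite_verts that] dist_cases by blast
  have "{0, 1, 2} - {0::nat} = {1, 2}" "{0, 1, 2} - {1::nat} = {0, 2}"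
    "{0, 1, 2} - {2::nat} = {0, 1}" by auto
  \<comment> \<open>Complementation pairs \<open>{1, 2}\<close> with \<open>{0}\<close>,
    \<open>{0, 2}\<close> with \<open>{1}\<close>, \<open>{0, 1}\<close> with \<open>{2}\<close>,
    and \<open>{0, 1, 2}\<close> with \<open>{}\<close>.\<close>
  then have magic: "\<not> D_magic G {1, 2}" "D_magic G {0, 2} \<longleftrightarrow> D_magic G {1}"
    "D_magic G {0, 1} \<longleftrightarrow> D_magic G {2}" "D_magic G {0, 1, 2}"
    using compl[of "{0}"] compl[of "{1}"] compl[of "{2}"] compl[of "{}"] not_D_magic_0 D_magic_empty
    by auto
  have "D \<in> Pow {0, 1, 2}"
    using assms(3) by blast
  then consider "D = {0}" | "D = {1}" | "D = {2}" | "D = {0, 1}" | "D = {0, 2}"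
    | "D = {1, 2}" | "D = {0, 1, 2}"
    using assms(4) by (auto simp: Pow_insert)
  then show ?thesis
    \<comment> \<open>Folding the structural conditions back into magicness for \<open>{1}\<close>
      and \<open>{2}\<close> leaves only the facts \<open>magic\<close> and
      \<open>not_D_magic_0\<close> to be compared in each case.\<close>
    unfolding assms(2) D_magic_1_iff[symmetric] D_magic_2_iff[symmetric]
    by cases (hypsubst, simp add: set_eq_subset magic not_D_magic_0 del: One_nat_def)+
qed

end
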